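(* Let $U,V\in C^\infty(\mathbb R)$ be arbitrary, put $W(x,y,z)=U(z)+xy\,V(z)$, and equip $\mathbb R^3$ (coordinates $x,y,z$) with the Poisson bivector $$\Pi=W\,\partial_x\wedge\partial_y-x\,\partial_x\wedge\partial_z+y\,\partial_y\wedge\partial_z$$ and the pseudo-Riemannian metric $g=2\,dx\,dy+dz^2$. Let $f(x,y,z)=2xy+W^2(x,y,z)$. Then every point $m=(x,y,z)\in\mathbb R^3$ with $f(m)=0$ belongs to exactly one of the following two classes: (i) $m$ is an $\mathcal M$-singular point; (ii) $\{m\}$ is a singular (point-like) symplectic leaf of $(\mathbb R^3,\Pi)$.
   Context: The Poisson brackets of $\Pi$ are $\{x,y\}=U(z)+V(z)xy$, $\{z,x\}=x$, $\{z,y\}=-y$. The metric satisfies $g(\partial_x,\partial_y)=1$, $g(\partial_z,\partial_z)=1$, and all other components (apart from those given by symmetry) are zero. $\Pi^\sharp:T^*\mathbb R^3\to T\mathbb R^3$ is given by $\beta(\Pi^\sharp\alpha)=\Pi(\alpha,\beta)$. The metriplectic tensor is the symmetric contravariant 2-tensor $\mathcal M(\alpha,\beta)=g(\Pi^\sharp\alpha,\Pi^\sharp\beta)$, with associated map $\mathcal M^\sharp$ given by $\beta(\mathcal M^\sharp\alpha)=\mathcal M(\alpha,\beta)$. A point $m$ is $\mathcal M$-regular if $\operatorname{Im}\Pi^\sharp_m=\operatorname{Im}\mathcal M^\sharp_m$, and $\mathcal M$-singular otherwise. The singular symplectic leaves are the zero-dimensional ones, i.e. the points where $\Pi$ vanishes;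 they are the points $(0,0,z)$ with $U(z)=0$. *)

theory Defs
  imports "HOL-Analysis.Analysis"
begin

text \<open>
  Points, tangent vectors and covectors are all elements of \<open>real^3\<close>, given by their components
  with respect to \<open>(x,y,z)\<close>, \<open>(\<partial>\<^sub>x,\<partial>\<^sub>y,\<partial>\<^sub>z)\<close> and \<open>(dx,dy,dz)\<close> respectively. The pairing of a
  covector with a tangent vector is therefore the inner product, and \<open>axis 1 1\<close>, \<open>axis 2 1\<close>,
  \<open>axis 3 1\<close> as covectors are \<open>dx\<close>, \<open>dy\<close>, \<open>dz\<close>.
\<close>

type_synonym contra2 = "real^3 \<Rightarrow> real^3 \<Rightarrow> real"

fun Ck :: "nat \<Rightarrow> ('a::euclidean_space \<Rightarrow> real) \<Rightarrow> bool" where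
  "Ck 0 f \<longleftrightarrow> continuous_on UNIV f"
| "Ck (Suc k) f \<longleftrightarrow> (\<forall>x. f differentiable (at x)) \<and>
     (\<forall>b\<in>Basis. Ck k (\<lambda>x. frechet_derivative f (at x) b))"

definition C_infinity :: "('a::euclidean_space \<Rightarrow> real) \<Rightarrow> bool" where
  "C_infinity f \<longleftrightarrow> (\<forall>k. Ck k f)"

definition sharp :: "contra2 \<Rightarrow> real^3 \<Rightarrow> real^3" where
  "sharp T \<alpha> = (\<chi> j. T \<alpha> (axis j 1))"

definition W :: "(real \<Rightarrow> real) \<Rightarrow> (real \<Rightarrow> real) \<Rightarrow> real^3 \<Rightarrow> real" where
  "W U V m = U (m$3) + m$1 * m$2 * V (m$3)"

definition Poisson :: "(real \<Rightarrow> real) \<Rightarrow> (real \<Rightarrow> real) \<Rightarrow> real^3 \<Rightarrow> contra2" where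
  "Poisson U V m \<alpha> \<beta> =
     W U V m * (\<alpha>$1 * \<beta>$2 - \<alpha>$2 * \<beta>$1)
     - m$1 * (\<alpha>$1 * \<beta>$3 - \<alpha>$3 * \<beta>$1)
     + m$2 * (\<alpha>$2 * \<beta>$3 - \<alpha>$3 * \<beta>$2)"

text \<open>The metric \<open>2 dx dy + dz\<^sup>2\<close> has constant components; it takes tangent vectors as arguments.\<close>

definition metric :: "real^3 \<Rightarrow> real^3 \<Rightarrow> real" where
  "metric v w = v$1 * w$2 + v$2 * w$1 + v$3 * w$3"

definition metriplectic :: "(real^3 \<Rightarrow> contra2) \<Rightarrow> real^3 \<Rightarrow> contra2" where
  "metriplectic P m \<alpha> \<beta> = metric (sharp (P m) \<alpha>) (sharp (P m) \<beta>)"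

text \<open>The defining property of the two maps \<open>\<Pi>\<^sup>\<sharp>\<close> and \<open>M\<^sup>\<sharp>\<close>.\<close>

lemma pairing_sharp:
  assumes "linear (T \<alpha>)"
  shows "\<beta> \<bullet> sharp T \<alpha> = T \<alpha> \<beta>"
proof -
  have "T \<alpha> \<beta> = T \<alpha> (\<Sum>j\<in>UNIV. \<beta>$j *\<^sub>R axis j 1)"
    using basis_expansion[of \<beta>] by (simp add: scalar_mult_eq_scaleR)
  also have "\<dots> = \<beta> \<bullet> sharp T \<alpha>"
    using assms by (simp add: linear_sum linear_cmul inner_vec_def sharp_def)
  finally show ?thesis by simp
qed

lemma pairing_sharp_Poisson: "\<beta> \<bullet> sharp (Poisson U V m) \<alpha> = Poisson U V m \<alpha> \<beta>"
  by (rule pairing_sharp, rule linearI) (simp_all add: Poisson_def algebra_simps)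

lemma pairing_sharp_metriplectic:
  "\<beta> \<bullet> sharp (metriplectic (Poisson U V) m) \<alpha> = metriplectic (Poisson U V) m \<alpha> \<beta>"
  by (rule pairing_sharp, rule linearI)
     (simp_all add: metriplectic_def metric_def sharp_def Poisson_def algebra_simps)

definition M_regular :: "(real^3 \<Rightarrow> contra2) \<Rightarrow> real^3 \<Rightarrow> bool" where
  "M_regular P m \<longleftrightarrow> range (sharp (P m)) = range (sharp (metriplectic P m))"

definition M_singular :: "(real^3 \<Rightarrow> contra2) \<Rightarrow> real^3 \<Rightarrow> bool" where
  "M_singular P m \<longleftrightarrow> \<not> M_regular P m"

definition differential :: "(real^3 \<Rightarrow> real) \<Rightarrow> real^3 \<Rightarrow> real^3" where
  "differential H p = (\<chi> i. frechet_derivative H (at p) (axis i 1))"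

definition Hamiltonian_field :: "(real^3 \<Rightarrow> contra2) \<Rightarrow> (real^3 \<Rightarrow> real) \<Rightarrow> real^3 \<Rightarrow> real^3" where
  "Hamiltonian_field P H p = sharp (P p) (differential H p)"

definition Hamiltonian_arc :: "(real^3 \<Rightarrow> contra2) \<Rightarrow> real^3 \<Rightarrow> real^3 \<Rightarrow> bool" where
  "Hamiltonian_arc P p q \<longleftrightarrow>
     (\<exists>H \<gamma> T. C_infinity H \<and> 0 \<le> T \<and> \<gamma> 0 = p \<and> \<gamma> T = q \<and>
        (\<forall>t\<in>{0..T}. (\<gamma> has_vector_derivative Hamiltonian_field P H (\<gamma> t)) (at t within {0..T})))"

text \<open>
  The leaf through \<open>p\<close> consists of the points reached from \<open>p\<close> along finitely many
  Hamiltonian arcs. Replacing \<open>H\<close> by \<open>-H\<close> reverses an arc, so this is an equivalence class.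
\<close>

definition leaf_through :: "(real^3 \<Rightarrow> contra2) \<Rightarrow> real^3 \<Rightarrow> (real^3) set" where
  "leaf_through P p = {q. (Hamiltonian_arc P)\<^sup>*\<^sup>* p q}"

definition symplectic_leaf :: "(real^3 \<Rightarrow> contra2) \<Rightarrow> (real^3) set \<Rightarrow> bool" where
  "symplectic_leaf P L \<longleftrightarrow> (\<exists>p. L = leaf_through P p)"

text \<open>
  A leaf is singular if it is zero-dimensional. The tangent space of a leaf at \<open>p\<close> is the image
  of \<open>\<Pi>\<^sup>\<sharp>\<close> at \<open>p\<close>.
\<close>

definition singular_leaf :: "(real^3 \<Rightarrow> contra2) \<Rightarrow> (real^3) set \<Rightarrow> bool" where
  "singular_leaf P L \<longleftrightarrow> symplectic_leaf P L \<and> (\<forall>p\<in>L. dim (range (sharp (P p))) = 0)"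

definition f :: "(real \<Rightarrow> real) \<Rightarrow> (real \<Rightarrow> real) \<Rightarrow> real^3 \<Rightarrow> real" where
  "f U V m = 2 * m$1 * m$2 + (W U V m)\<^sup>2"

end

theory Submission
  imports Defs
begin

text \<open>
  Write \<open>n = (y, x, W)\<close> and \<open>u = (x, y, W)\<close>, the metric dual of \<open>n\<close>. In the standard inner product,
  \<open>\<Pi>\<^sup>\<sharp>\<alpha> = n \<times> \<alpha>\<close>, so \<open>u\<close> is metrically orthogonal to \<open>Im \<Pi>\<^sup>\<sharp>\<close>, and
  \<open>f = n \<bullet> u\<close> vanishes at \<open>m\<close> iff \<open>\<Pi>\<^sup>\<sharp>(\<Pi>\<^sup>\<sharp>u) = n \<times> (n \<times> u) = -|n|\<^sup>2u\<close>.
  If moreover \<open>b = \<Pi>\<^sup>\<sharp>u\<close> equals some \<open>M\<^sup>\<sharp>\<alpha>\<close>, then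
  \<open>|b|\<^sup>2 = M(\<alpha>, b) = -|n|\<^sup>2 g(\<Pi>\<^sup>\<sharp>\<alpha>, u) = 0\<close>, hence \<open>u = 0\<close>, i.e. \<open>\<Pi>\<close> vanishes at \<open>m\<close>.
  So on \<open>f = 0\<close> the regular points are the zeros of \<open>\<Pi>\<close>. At such a zero every Hamiltonian
  field is bounded by a multiple of the distance to \<open>m\<close>, so by Gronwall no Hamiltonian arc
  leaves \<open>m\<close>, and the leaf is \<open>{m}\<close>.
\<close>

section \<open>Local bounds for smooth functions and a Gronwall estimate\<close>

lemma C_infinity_differentiable:
  assumes "C_infinity h"
  shows "h differentiable (at x)"
  using assms Ck.simps(2)[of 0 h] unfolding C_infinity_def by blast

lemma C_infinity_continuous_derivative:
  assumes "C_infinity h" "b \<in> Basis"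
  shows "continuous_on UNIV (\<lambda>x. frechet_derivative h (at x) b)"
  using assms Ck.simps(1) Ck.simps(2)[of 0 h] unfolding C_infinity_def by blast

lemma C_infinity_continuous: "C_infinity h \<Longrightarrow> continuous_on UNIV h"
  using Ck.simps(1)[of h] unfolding C_infinity_def by blast

lemma continuous_bounded_on_cball:
  fixes h :: "'a::euclidean_space \<Rightarrow> 'b::real_normed_vector"
  assumes "continuous_on UNIV h"
  obtains B where "B \<ge> 0" "\<And>x. x \<in> cball a R \<Longrightarrow> norm (h x) \<le> B"
proof -
  have "compact (h ` cball a R)"
    using assms by (intro compact_continuous_image) (auto intro: continuous_on_subset)
  then obtain B where "\<forall>x\<in>h ` cball a R. norm x \<le> B"
    using compact_imp_bounded bounded_iff by metis
  then have "norm (h x) \<le> max B 0" if "x \<in> cball a R" for x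
    using that by (meson imageI max.cobounded1 order_trans)
  then show ?thesis
    by (intro that[of "max B 0"]) simp_all
qed

text \<open>Mean value inequality: the continuous derivative is bounded on the compact ball.\<close>

lemma C_infinity_lipschitz_at:
  fixes h :: "real \<Rightarrow> real"
  assumes "C_infinity h"
  obtains L where "L \<ge> 0" "\<And>z. z \<in> cball a R \<Longrightarrow> \<bar>h z - h a\<bar> \<le> L * \<bar>z - a\<bar>"
proof -
  let ?D = "\<lambda>x. frechet_derivative h (at x) 1"
  obtain L where L: "L \<ge> 0" "\<And>x. x \<in> cball a R \<Longrightarrow> norm (?D x) \<le> L"
    using continuous_bounded_on_cball[OF C_infinity_continuous_derivative[OF assms, of 1]]
    by (metis Basis_real_def singletonI)
  have D: "(h has_field_derivative ?D x) (at x within cball a R)" for x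
  proof -
    have hd: "(h has_derivative frechet_derivative h (at x)) (at x)"
      using C_infinity_differentiable[OF assms] frechet_derivative_works by blast
    have "frechet_derivative h (at x) = (*) (?D x)"
    proof
      fix r show "frechet_derivative h (at x) r = ?D x * r"
        using linear_cmul[OF has_derivative_linear[OF hd], of r 1] by simp
    qed
    with hd show ?thesis
      by (metis has_field_derivative_def has_field_derivative_at_within)
  qed
  show ?thesis
  proof (rule that[OF L(1)])
    fix z assume z: "z \<in> cball a R"
    \<comment> \<open>The sign of \<open>R\<close> is free; a point of the ball forces
      \<open>0 \<le> R\<close>, so the centre lies in it too.\<close>
    then have a: "a \<in> cball a R"
      using zero_le_dist[of a z] by (auto simp del: zero_le_dist)
    show "\<bar>h z - h a\<bar> \<le> L * \<bar>z - a\<bar>"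
      using field_differentiable_bound[OF convex_cball D L(2) z a] by simp
  qed
qed

text \<open>The squared distance to the start, weighted by the integrating factor
  \<open>exp (-2 * C * t)\<close>, has nonpositive derivative and starts at 0.\<close>

lemma linear_growth_imp_stationary:
  fixes \<gamma> :: "real \<Rightarrow> 'a::real_inner"
  assumes deriv: "\<And>t. t \<in> {0..T} \<Longrightarrow> (\<gamma> has_vector_derivative v t) (at t within {0..T})"
    and growth: "\<And>t. t \<in> {0..T} \<Longrightarrow> norm (v t) \<le> C * norm (\<gamma> t - \<gamma> 0)"
    and T: "0 \<le> T"
  shows "\<gamma> T = \<gamma> 0"
proof (cases "T = 0")
  case False
  then have "0 < T" using T by simp
  define w where "w t = \<gamma> t - \<gamma> 0" for t
  let ?\<phi> = "\<lambda>t. exp (-2 * C * t) * (w t \<bullet> w t)"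
  let ?\<phi>' = "\<lambda>t. exp (-2 * C * t) * (2 * (w t \<bullet> v t) - 2 * C * (w t \<bullet> w t))"
  have w': "(w has_derivative (\<lambda>s. s *\<^sub>R v t)) (at t within {0..T})" if "t \<in> {0..T}" for t
    using deriv[OF that] unfolding w_def has_vector_derivative_def
    by (auto intro!: derivative_eq_intros)
  have \<phi>': "(?\<phi> has_derivative (\<lambda>s. s * ?\<phi>' t)) (at t within {0..T})" if "t \<in> {0..T}" for t
    by (rule derivative_eq_intros w'[OF that] refl)+
      (auto simp: algebra_simps inner_commute)
  \<comment> \<open>Only the values at \<open>0\<close> and \<open>T\<close> are compared, so one
    mean value point suffices.\<close>
  obtain t where t: "t \<in> {0<..<T}" "?\<phi> T - ?\<phi> 0 = (T - 0) * ?\<phi>' t"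
    using mvt_simple[OF \<open>0 < T\<close>, of ?\<phi> "\<lambda>t s. s * ?\<phi>' t"] \<phi>' by auto
  have "w t \<bullet> v t \<le> norm (w t) * norm (v t)"
    by (rule norm_cauchy_schwarz)
  also have "\<dots> \<le> norm (w t) * (C * norm (w t))"
    using growth[of t] t by (intro mult_left_mono) (auto simp: w_def)
  also have "\<dots> = C * (w t \<bullet> w t)"
    by (simp add: power2_norm_eq_inner[symmetric] power2_eq_square)
  finally have "?\<phi>' t \<le> 0"
    by (intro mult_nonneg_nonpos) auto
  then have "?\<phi> T - ?\<phi> 0 \<le> 0"
    using t T by (simp add: mult_nonneg_nonpos)
  then have "exp (-2 * C * T) * (w T \<bullet> w T) \<le> 0"
    by (simp add: w_def)
  then have "w T \<bullet> w T \<le> 0"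
    by (simp add: mult_le_0_iff not_le)
  then have "w T = 0"
    by (metis inner_eq_zero_iff inner_ge_zero order_antisym)
  then show ?thesis
    by (simp add: w_def)
qed simp

section \<open>Size of the Poisson tensor near its zeros\<close>

lemma sharp_Poisson_components:
  "sharp (Poisson U V m) \<alpha> $ 1 = m$1 * \<alpha>$3 - W U V m * \<alpha>$2"
  "sharp (Poisson U V m) \<alpha> $ 2 = W U V m * \<alpha>$1 - m$2 * \<alpha>$3"
  "sharp (Poisson U V m) \<alpha> $ 3 = m$2 * \<alpha>$2 - m$1 * \<alpha>$1"
  by (simp_all add: sharp_def Poisson_def axis_def)

lemma norm_sharp_Poisson_le:
  "norm (sharp (Poisson U V m) \<alpha>) \<le> 2 * (\<bar>W U V m\<bar> + \<bar>m$1\<bar> + \<bar>m$2\<bar>) * norm \<alpha>"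
proof -
  have diff: "\<bar>c * \<alpha>$i - d * \<alpha>$j\<bar> \<le> (\<bar>c\<bar> + \<bar>d\<bar>) * norm \<alpha>" for c d i j
  proof -
    have "\<bar>c * \<alpha>$i - d * \<alpha>$j\<bar> \<le> \<bar>c\<bar> * \<bar>\<alpha>$i\<bar> + \<bar>d\<bar> * \<bar>\<alpha>$j\<bar>"
      unfolding abs_mult[symmetric] by (rule abs_triangle_ineq4)
    also have "\<dots> \<le> \<bar>c\<bar> * norm \<alpha> + \<bar>d\<bar> * norm \<alpha>"
      by (intro add_mono mult_left_mono component_le_norm_cart) auto
    finally show ?thesis by (simp add: distrib_right)
  qed
  have "norm (sharp (Poisson U V m) \<alpha>) \<le> (\<Sum>i\<in>UNIV. \<bar>sharp (Poisson U V m) \<alpha> $ i\<bar>)"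
    by (rule norm_le_l1_cart)
  also have "\<dots> \<le> (\<bar>m$1\<bar> + \<bar>W U V m\<bar>) * norm \<alpha> + (\<bar>W U V m\<bar> + \<bar>m$2\<bar>) * norm \<alpha>
      + (\<bar>m$2\<bar> + \<bar>m$1\<bar>) * norm \<alpha>"
    unfolding sum_3 sharp_Poisson_components by (intro add_mono diff)
  \<comment> \<open>Each of the three coefficients enters two components, hence the factor
    2.\<close>
  also have "\<dots> = 2 * (\<bar>W U V m\<bar> + \<bar>m$1\<bar> + \<bar>m$2\<bar>) * norm \<alpha>"
    by (simp add: algebra_simps)
  finally show ?thesis .
qed

text \<open>\<open>U\<close> is Lipschitz at its zero \<open>m$3\<close>, while the other term of
  \<open>W\<close> is quadratic in the distance to \<open>m\<close>, with bounded factor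
  \<open>V\<close>.\<close>

lemma W_linear_growth:
  assumes "C_infinity U" "C_infinity V" "m$1 = 0" "m$2 = 0" "W U V m = 0"
  obtains K where "K \<ge> 0" "\<And>p. p \<in> cball m R \<Longrightarrow> \<bar>W U V p\<bar> \<le> K * norm (p - m)"
proof -
  have U0: "U (m$3) = 0"
    using assms by (simp add: W_def)
  obtain L where L: "L \<ge> 0"
      "\<And>z. z \<in> cball (m$3) R \<Longrightarrow> \<bar>U z - U (m$3)\<bar> \<le> L * \<bar>z - m$3\<bar>"
    using C_infinity_lipschitz_at[OF assms(1)] by blast
  obtain B where B: "B \<ge> 0" "\<And>z. z \<in> cball (m$3) R \<Longrightarrow> norm (V z) \<le> B"
    using continuous_bounded_on_cball[OF C_infinity_continuous[OF assms(2)]] by blast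
  show ?thesis
  proof (rule that[of "L + \<bar>R\<bar> * B"])
    show "L + \<bar>R\<bar> * B \<ge> 0" using L B by simp
  next
    fix p assume p: "p \<in> cball m R"
    have c: "\<bar>p$i - m$i\<bar> \<le> norm (p - m)" for i
      using component_le_norm_cart[of "p - m" i] by simp
    have R: "norm (p - m) \<le> R"
      using p by (simp add: dist_norm norm_minus_commute)
    then have z: "p$3 \<in> cball (m$3) R"
      using c[of 3] by (simp add: dist_real_def abs_minus_commute)
    \<comment> \<open>One coordinate keeps the distance, the other is absorbed into the
      radius.\<close>
    have "\<bar>p$1\<bar> * \<bar>p$2\<bar> * \<bar>V (p$3)\<bar> \<le> norm (p - m) * \<bar>R\<bar> * B"
      using c[of 1] c[of 2] assms R B(1) B(2)[OF z] by (intro mult_mono) auto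
    moreover have "\<bar>U (p$3)\<bar> \<le> L * norm (p - m)"
      using L(2)[OF z] U0 mult_left_mono[OF c[of 3] L(1)] by simp
    moreover have "\<bar>W U V p\<bar> \<le> \<bar>U (p$3)\<bar> + \<bar>p$1\<bar> * \<bar>p$2\<bar> * \<bar>V (p$3)\<bar>"
      unfolding W_def abs_mult[symmetric] by (rule abs_triangle_ineq)
    ultimately show "\<bar>W U V p\<bar> \<le> (L + \<bar>R\<bar> * B) * norm (p - m)"
      by (simp add: algebra_simps)
  qed
qed

section \<open>Leaves through zeros of the Poisson tensor\<close>

lemma continuous_differential:
  assumes "C_infinity H"
  shows "continuous_on UNIV (differential H)"
  unfolding differential_def
  by (intro continuous_on_vec_lambda C_infinity_continuous_derivative[OF assms])
    simp

lemma Hamiltonian_arc_zero: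
  assumes U: "C_infinity U" and V: "C_infinity V"
    and zero: "m$1 = 0" "m$2 = 0" "W U V m = 0"
    and arc: "Hamiltonian_arc (Poisson U V) m q"
  shows "q = m"
proof -
  obtain H \<gamma> T where H: "C_infinity H" and T: "0 \<le> T" and ends: "\<gamma> 0 = m" "\<gamma> T = q"
    and deriv: "\<And>t. t \<in> {0..T} \<Longrightarrow>
      (\<gamma> has_vector_derivative Hamiltonian_field (Poisson U V) H (\<gamma> t)) (at t within {0..T})"
    using arc unfolding Hamiltonian_arc_def by blast
  \<comment> \<open>The arc is compact, so one ball contains it and uniform constants
    \<open>K\<close> and \<open>D\<close> exist there.\<close>
  have "continuous_on {0..T} \<gamma>"
    using deriv has_vector_derivative_continuous continuous_on_eq_continuous_within by blast
  then have "bounded (\<gamma> ` {0..T})"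
    by (intro compact_imp_bounded compact_continuous_image) auto
  then obtain R where "\<gamma> ` {0..T} \<subseteq> ball m R"
    using bounded_subset_ballD by blast
  then have R: "\<And>t. t \<in> {0..T} \<Longrightarrow> \<gamma> t \<in> cball m R"
    using ball_subset_cball by blast
  obtain K where K: "K \<ge> 0" "\<And>p. p \<in> cball m R \<Longrightarrow> \<bar>W U V p\<bar> \<le> K * norm (p - m)"
    using W_linear_growth[OF U V zero] by blast
  obtain D where D: "D \<ge> 0" "\<And>p. p \<in> cball m R \<Longrightarrow> norm (differential H p) \<le> D"
    using continuous_bounded_on_cball[OF continuous_differential[OF H]] by blast
  \<comment> \<open>In the constant, \<open>K\<close> accounts for \<open>W\<close>, the inner 2 for
    the coordinates \<open>p$1\<close> and \<open>p$2\<close>, and \<open>D\<close> for the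
    differential of \<open>H\<close>.\<close>
  have "norm (Hamiltonian_field (Poisson U V) H p) \<le> (2 * (K + 2) * D) * norm (p - m)"
    if p: "p \<in> cball m R" for p
  proof -
    have "\<bar>p$1\<bar> \<le> norm (p - m)" "\<bar>p$2\<bar> \<le> norm (p - m)"
      using component_le_norm_cart[of "p - m" 1] component_le_norm_cart[of "p - m" 2] zero by auto
    then have "2 * (\<bar>W U V p\<bar> + \<bar>p$1\<bar> + \<bar>p$2\<bar>) \<le> 2 * (K + 2) * norm (p - m)"
      using K(2)[OF p] by (simp add: algebra_simps)
    then have "2 * (\<bar>W U V p\<bar> + \<bar>p$1\<bar> + \<bar>p$2\<bar>) * norm (differential H p)
        \<le> 2 * (K + 2) * norm (p - m) * D"
      using D(2)[OF p] by (rule mult_mono) (use K(1) in simp_all)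
    then show ?thesis
      using norm_sharp_Poisson_le[of U V p "differential H p"]
      unfolding Hamiltonian_field_def by (simp add: mult_ac)
  qed
  then have "\<gamma> T = \<gamma> 0"
    using R ends(1) by (intro linear_growth_imp_stationary[OF deriv _ T]) auto
  then show ?thesis using ends by simp
qed

lemma leaf_through_zero:
  assumes "C_infinity U" "C_infinity V" "m$1 = 0" "m$2 = 0" "W U V m = 0"
  shows "leaf_through (Poisson U V) m = {m}"
proof -
  have "q = m" if "(Hamiltonian_arc (Poisson U V))\<^sup>*\<^sup>* m q" for q
    using that by induction (use Hamiltonian_arc_zero[OF assms] in auto)
  then show ?thesis
    unfolding leaf_through_def by auto
qed

lemma singular_leaf_singleton_iff:
  assumes "C_infinity U" "C_infinity V"
  shows "singular_leaf (Poisson U V) {m} \<longleftrightarrow> m$1 = 0 \<and> m$2 = 0 \<and> W U V m = 0"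
proof
  assume "singular_leaf (Poisson U V) {m}"
  then have 0: "sharp (Poisson U V m) \<alpha> = 0" for \<alpha>
    unfolding singular_leaf_def by (auto simp: dim_eq_0)
  \<comment> \<open>The images of \<open>dx\<close> and \<open>dy\<close> are
    \<open>(0, W, -x)\<close> and \<open>(-W, 0, y)\<close>.\<close>
  show "m$1 = 0 \<and> m$2 = 0 \<and> W U V m = 0"
    using sharp_Poisson_components[of U V m "axis 1 1"] sharp_Poisson_components[of U V m "axis 2 1"]
    by (simp add: 0 axis_def)
next
  assume z: "m$1 = 0 \<and> m$2 = 0 \<and> W U V m = 0"
  then have "sharp (Poisson U V m) \<alpha> = 0" for \<alpha>
    by (simp add: vec_eq_iff forall_3 sharp_Poisson_components)
  then have "range (sharp (Poisson U V m)) \<subseteq> {0}" by auto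
  then show "singular_leaf (Poisson U V) {m}"
    using leaf_through_zero[OF assms, of m] z
    unfolding singular_leaf_def symplectic_leaf_def by (auto simp: dim_eq_0)
qed

section \<open>Regularity on the zero set of \<open>f\<close>\<close>

lemma M_regular_iff:
  assumes "f U V m = 0"
  shows "M_regular (Poisson U V) m \<longleftrightarrow> m$1 = 0 \<and> m$2 = 0 \<and> W U V m = 0"
proof
  assume reg: "M_regular (Poisson U V) m"
  let ?P = "sharp (Poisson U V m)"
  define u :: "real^3" where "u = vector [m$1, m$2, W U V m]"
  have fm: "2 * m$1 * m$2 + (W U V m)\<^sup>2 = 0"
    using assms by (simp add: f_def)
  have u [simp]: "u$1 = m$1" "u$2 = m$2" "u$3 = W U V m"
    by (simp_all add: u_def)
  have PPu: "?P (?P u) = - (u \<bullet> u) *\<^sub>R u"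
  proof -
    define x y w where "x = m$1" and "y = m$2" and "w = W U V m"
    note xyw = x_def[symmetric] y_def[symmetric] w_def[symmetric]
    have "w\<^sup>2 = - 2 * x * y"
      using fm by (simp add: x_def y_def w_def)
    \<comment> \<open>This is \<open>n \<times> (n \<times> u) = (n \<bullet> u) n - |n|^2 u\<close>
      in coordinates; \<open>n\<close> and \<open>u\<close> differ by a swap of coordinates, so
      \<open>|n| = |u|\<close>.\<close>
    moreover have "?P (?P u) $ 1 + (u \<bullet> u) * u$1 = y * (2 * x * y + w\<^sup>2)"
      "?P (?P u) $ 2 + (u \<bullet> u) * u$2 = x * (2 * x * y + w\<^sup>2)"
      "?P (?P u) $ 3 + (u \<bullet> u) * u$3 = w * (2 * x * y + w\<^sup>2)"
      unfolding sharp_Poisson_components inner_vec_def sum_3 inner_real_def u xyw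
      by (simp_all add: algebra_simps power2_eq_square)
    ultimately show ?thesis
      by (simp add: vec_eq_iff forall_3)
  qed
  \<comment> \<open>\<open>metric v u\<close> equals \<open>v \<bullet> n\<close>, and
    \<open>n \<times> \<alpha>\<close> is orthogonal to \<open>n\<close>.\<close>
  have orth: "metric (?P \<alpha>) (?P (?P u)) = 0" for \<alpha>
    unfolding PPu metric_def vector_scaleR_component sharp_Poisson_components u real_scaleR_def
    by (simp add: algebra_simps)
  obtain \<alpha> where \<alpha>: "?P u = sharp (metriplectic (Poisson U V) m) \<alpha>"
    using reg unfolding M_regular_def by (metis rangeE rangeI)
  \<comment> \<open>The vector \<open>?P u\<close> is reused, through its components, as the
    covector to pair with.\<close>
  have "?P u \<bullet> ?P u = metriplectic (Poisson U V) m \<alpha> (?P u)"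
    by (metis \<alpha> pairing_sharp_metriplectic)
  also have "\<dots> = 0"
    unfolding metriplectic_def by (rule orth)
  finally have Pu: "?P u = 0" by simp
  have "?P 0 = 0"
    by (simp add: vec_eq_iff forall_3 sharp_Poisson_components)
  then have "u = 0"
    using PPu unfolding Pu by auto
  then show "m$1 = 0 \<and> m$2 = 0 \<and> W U V m = 0"
    by (metis u zero_index)
next
  assume "m$1 = 0 \<and> m$2 = 0 \<and> W U V m = 0"
  then have "sharp (Poisson U V m) \<alpha> = 0" for \<alpha>
    by (simp add: vec_eq_iff forall_3 sharp_Poisson_components)
  then have "sharp (metriplectic (Poisson U V) m) = sharp (Poisson U V m)"
    by (auto simp: fun_eq_iff vec_eq_iff sharp_def[of "metriplectic _ _"] metriplectic_def metric_def)
  then show "M_regular (Poisson U V) m"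
    by (simp add: M_regular_def)
qed

theorem proposition6p1:
  fixes U V :: "real \<Rightarrow> real" and m :: "real^3"
  assumes "C_infinity U" and "C_infinity V" and "f U V m = 0"
  shows "(M_singular (Poisson U V) m \<and> \<not> singular_leaf (Poisson U V) {m}) \<or>
         (\<not> M_singular (Poisson U V) m \<and> singular_leaf (Poisson U V) {m})"
  \<comment> \<open>Regularity and being a point leaf both amount to \<open>x = y = W = 0\<close>,
    so the two classes are complementary.\<close>
  using M_regular_iff[OF assms(3)] singular_leaf_singleton_iff[OF assms(1,2)]
  unfolding M_singular_def by blast

end
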